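(* For every integer $r\ge3$ there exists an election $E=(N,C,A,k)$ with $m=|C|$ candidates and $m-k=r$ in which the committee returned by Reverse Sequential PAV violates Extended Justified Representation (EJR).
   Context: An election is a tuple $E=(N,C,A,k)$, where $N=\{1,\ldots,n\}$ is a set of voters, $C$ is a set of $m$ candidates, $A=(A_i)_{i\in N}$ is a profile of approval ballots $A_i\subseteq C$, and $k$ is the desired committee size. It is assumed that $1\le k<m$ and that $A_i\ne\emptyset$ for at least one voter $i$. A committee is a set $W\subseteq C$ with $|W|=k$. For an integer $t\ge 0$, $H(t)=\sum_{j=1}^{t}1/j$ (so $H(0)=0$). For $S\subseteq C$, $\operatorname{PAV}(S)=\sum_{i\in N}H(|A_i\cap S|)$, and for $c\in S$ the marginal loss is $\Delta_S(c)=\operatorname{PAV}(S)-\operatorname{PAV}(S\setminus\{c\})$. Reverse Sequential PAV: let $C_m=C$; for $s=m,m-1,\ldots,k+1$ pick $c_s\in\arg\min_{c\in C_s}\Delta_{C_s}(c)$ and set $C_{s-1}=C_s\setminus\{c_s\}$; return $W=C_k$. Ties are resolved using a fixed priority (linear) order on candidates. For an integer $\ell\ge1$, a group of voters $V\subseteq N$ is $\ell$-cohesive if $|V|\ge \ell n/k$ and $|\bigcap_{i\in V}A_i|\ge \ell$. A committee $W$ satisfies EJR if for every integer $\ell\ge1$ and every $\ell$-cohesive group $V$ there is a voter $i\in V$ with $|A_i\cap W|\ge\ell$; otherwise it violates EJR. *)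

theory Defs
  imports "HOL-Analysis.Harmonic_Numbers"
begin

record 'c election =
  num_voters :: nat
  candidates :: "'c set"
  ballot :: "nat \<Rightarrow> 'c set"
  committee_size :: nat

definition voters :: "'c election \<Rightarrow> nat set" where
  "voters E = {1..num_voters E}"

definition valid_election :: "'c election \<Rightarrow> bool" where
  "valid_election E \<longleftrightarrow>
     finite (candidates E) \<and>
     (\<forall>i \<in> voters E. ballot E i \<subseteq> candidates E) \<and>
     1 \<le> committee_size E \<and> committee_size E < card (candidates E) \<and>
     (\<exists>i \<in> voters E. ballot E i \<noteq> {})"

definition committee :: "'c election \<Rightarrow> 'c set \<Rightarrow> bool" where
  "committee E W \<longleftrightarrow> W \<subseteq> candidates E \<and> card W = committee_size E"

definition pav_score :: "'c election \<Rightarrow> 'c set \<Rightarrow> real" where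
  "pav_score E S = (\<Sum>i \<in> voters E. harm (card (ballot E i \<inter> S)))"

definition marginal_loss :: "'c election \<Rightarrow> 'c set \<Rightarrow> 'c \<Rightarrow> real" where
  "marginal_loss E S c = pav_score E S - pav_score E (S - {c})"

definition min_loss_candidates :: "'c election \<Rightarrow> 'c set \<Rightarrow> 'c set" where
  "min_loss_candidates E S = {c. is_arg_min (marginal_loss E S) (\<lambda>c. c \<in> S) c}"

text \<open>
  The priority order \<open>prio\<close> is a linear order given as a set of pairs; \<open>(c, d) \<in> prio\<close> means that
  \<open>c\<close> is removed in preference to \<open>d\<close> when both have minimal marginal loss. (The opposite
  convention amounts to replacing \<open>prio\<close> by its converse, which is again a linear order.)
  The definite description is justified by \<open>removed_candidate_unique\<close> below.
\<close>

definition removed_candidate :: "'c rel \<Rightarrow> 'c election \<Rightarrow> 'c set \<Rightarrow> 'c" where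
  "removed_candidate prio E S =
     (THE c. c \<in> min_loss_candidates E S \<and> (\<forall>d \<in> min_loss_candidates E S. (c, d) \<in> prio))"

definition removal_step :: "'c rel \<Rightarrow> 'c election \<Rightarrow> 'c set \<Rightarrow> 'c set" where
  "removal_step prio E S = S - {removed_candidate prio E S}"

definition reverse_seq_pav :: "'c rel \<Rightarrow> 'c election \<Rightarrow> 'c set" where
  "reverse_seq_pav prio E =
     (removal_step prio E ^^ (card (candidates E) - committee_size E)) (candidates E)"

definition cohesive :: "'c election \<Rightarrow> nat \<Rightarrow> nat set \<Rightarrow> bool" where
  "cohesive E l V \<longleftrightarrow>
     V \<subseteq> voters E \<and>
     real (card V) \<ge> real l * real (num_voters E) / real (committee_size E) \<and>
     card (\<Inter>i \<in> V. ballot E i) \<ge> l"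

definition satisfies_EJR :: "'c election \<Rightarrow> 'c set \<Rightarrow> bool" where
  "satisfies_EJR E W \<longleftrightarrow>
     (\<forall>l \<ge> 1. \<forall>V. cohesive E l V \<longrightarrow> (\<exists>i \<in> V. card (ballot E i \<inter> W) \<ge> l))"

lemma finite_linear_order_least:
  assumes "linear_order prio" "finite M" "M \<noteq> {}"
  shows "\<exists>c \<in> M. \<forall>d \<in> M. (c, d) \<in> prio"
  using assms(2,3)
proof (induction M rule: finite_ne_induct)
  case (singleton x)
  then show ?case
    using assms(1) by (auto simp: order_on_defs refl_on_def)
next
  case (insert x F)
  then obtain c where c: "c \<in> F" "\<forall>d \<in> F. (c, d) \<in> prio" by blast
  have refl: "(x, x) \<in> prio" and tot: "(x, c) \<in> prio \<or> (c, x) \<in> prio"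
    using assms(1) unfolding order_on_defs refl_on_def total_on_def by (metis UNIV_I)+
  have "trans prio" using assms(1) by (auto simp: order_on_defs)
  then show ?case using c refl tot by (blast dest: transD)
qed

lemma removed_candidate_unique:
  assumes "linear_order prio" "finite S" "S \<noteq> {}"
  shows "\<exists>!c. c \<in> min_loss_candidates E S \<and> (\<forall>d \<in> min_loss_candidates E S. (c, d) \<in> prio)"
proof -
  have "min_loss_candidates E S \<subseteq> S"
    by (auto simp: min_loss_candidates_def is_arg_min_def)
  moreover have "min_loss_candidates E S \<noteq> {}"
    using ex_is_arg_min_if_finite[OF assms(2,3), of "marginal_loss E S"]
    by (auto simp: min_loss_candidates_def)
  ultimately have "\<exists>c \<in> min_loss_candidates E S. \<forall>d \<in> min_loss_candidates E S. (c, d) \<in> prio"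
    using finite_linear_order_least[OF assms(1)] assms(2) finite_subset by metis
  moreover have "antisym prio" using assms(1) by (auto simp: order_on_defs)
  ultimately show ?thesis by (blast dest: antisymD)
qed

lemma removed_candidate_in:
  assumes "linear_order prio" "finite S" "S \<noteq> {}"
  shows "removed_candidate prio E S \<in> min_loss_candidates E S" "removed_candidate prio E S \<in> S"
  using theI'[OF removed_candidate_unique[OF assms, of E]]
  by (auto simp: removed_candidate_def min_loss_candidates_def is_arg_min_def)

lemma committee_reverse_seq_pav:
  assumes "linear_order prio" "valid_election E"
  shows "committee E (reverse_seq_pav prio E)"
proof -
  let ?C = "candidates E"
  have fin: "finite ?C" and k: "committee_size E < card ?C"
    using assms(2) by (auto simp: valid_election_def)
  have "(removal_step prio E ^^ j) ?C \<subseteq> ?C \<and> card ((removal_step prio E ^^ j) ?C) = card ?C - j"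
    if "j \<le> card ?C" for j
    using that
  proof (induction j)
    case 0
    then show ?case by simp
  next
    case (Suc j)
    let ?S = "(removal_step prio E ^^ j) ?C"
    have S: "?S \<subseteq> ?C" "card ?S = card ?C - j" using Suc by auto
    then have "finite ?S" "?S \<noteq> {}" using fin Suc.prems finite_subset by auto
    then have "removed_candidate prio E ?S \<in> ?S"
      by (rule removed_candidate_in(2)[OF assms(1)])
    moreover have "(removal_step prio E ^^ Suc j) ?C = ?S - {removed_candidate prio E ?S}"
      by (simp add: removal_step_def[of prio E ?S])
    ultimately show ?case using S by auto
  qed
  from this[of "card ?C - committee_size E"] k show ?thesis
    by (simp add: committee_def reverse_seq_pav_def)
qed

end

theory Submission
  imports Defs
begin

text \<open>
  With committee size 16, take five voters approving \<open>{0, 1}\<close>, five approving \<open>{0, 2}\<close>, three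
  approving \<open>{1}\<close>, three approving \<open>{2}\<close>, nine approving \<open>{c}\<close> for each \<open>c\<close> from 3 to 18, and
  \<open>r - 3\<close> further candidates approved by nobody. The latter have loss 0 and go first. Then the losses
  of \<open>0\<close>, of \<open>1\<close> and \<open>2\<close>, and of the others are 5, 11/2 and 9, so \<open>0\<close> goes. This raises the losses of
  \<open>1\<close> and \<open>2\<close> only to 8, so both of them go as well. The first ten voters, who are 1-cohesive through
  candidate \<open>0\<close> since 10 = 160/16, end up with no approved candidate in the committee.
\<close>

text \<open>Deleting \<open>c\<close> shortens exactly the ballots of its approvers by one
  candidate, and H(t) - H(t - 1) = 1/t.\<close>

lemma marginal_loss_eq:
  assumes "finite S" "c \<in> S"
  shows "marginal_loss E S c =
    (\<Sum>i | i \<in> voters E \<and> c \<in> ballot E i. 1 / real (card (ballot E i \<inter> S)))"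
proof -
  have "harm (card (ballot E i \<inter> S)) - harm (card (ballot E i \<inter> (S - {c}))) =
      (if c \<in> ballot E i then 1 / real (card (ballot E i \<inter> S)) else 0)" for i
  proof (cases "c \<in> ballot E i")
    case True
    then have eq: "ballot E i \<inter> S = insert c (ballot E i \<inter> (S - {c}))"
      using assms by auto
    have "card (ballot E i \<inter> S) = Suc (card (ballot E i \<inter> (S - {c})))"
      by (subst eq, subst card_insert_disjoint) (use assms in auto)
    with True show ?thesis by (simp add: harm_Suc inverse_eq_divide)
  next
    case False
    then have "ballot E i \<inter> (S - {c}) = ballot E i \<inter> S" by auto
    with False show ?thesis by simp
  qed
  then have "marginal_loss E S c =
      (\<Sum>i \<in> voters E. if c \<in> ballot E i then 1 / real (card (ballot E i \<inter> S)) else 0)"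
    by (simp add: marginal_loss_def pav_score_def flip: sum_subtractf)
  also have "\<dots> = (\<Sum>i | i \<in> voters E \<and> c \<in> ballot E i. 1 / real (card (ballot E i \<inter> S)))"
    by (rule sum.inter_filter[symmetric]) (simp add: voters_def)
  finally show ?thesis .
qed

text \<open>A strict advantage of one member of \<open>R\<close> over all of \<open>Q\<close> forces
  every minimiser into \<open>R\<close>, whatever the ties. Which members of \<open>P\<close> go
  first depends on \<open>prio\<close>, so the hypothesis covers every nonempty \<open>R\<close>
  that can be left over.\<close>

lemma removal_steps_block:
  assumes "linear_order prio" "finite P" "finite Q" "P \<inter> Q = {}"
    and "\<And>R. R \<subseteq> P \<Longrightarrow> R \<noteq> {} \<Longrightarrow>
      \<exists>p \<in> R. \<forall>q \<in> Q. marginal_loss E (R \<union> Q) p < marginal_loss E (R \<union> Q) q"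
  shows "(removal_step prio E ^^ card P) (P \<union> Q) = Q"
  using assms(2,4,5)
proof (induction "card P" arbitrary: P)
  case 0
  then show ?case by simp
next
  case (Suc n)
  let ?c = "removed_candidate prio E (P \<union> Q)"
  have "P \<noteq> {}" using Suc.hyps(2) by auto
  then obtain p where p: "p \<in> P"
    "\<forall>q \<in> Q. marginal_loss E (P \<union> Q) p < marginal_loss E (P \<union> Q) q"
    using Suc.prems(3)[of P] by blast
  have "?c \<in> min_loss_candidates E (P \<union> Q)"
    by (rule removed_candidate_in(1)[OF assms(1)]) (use Suc.prems assms(3) p in auto)
  \<comment> \<open>A minimiser in \<open>Q\<close> would be strictly beaten by
    \<open>p\<close>.\<close>
  then have c: "?c \<in> P"
    using p by (auto simp: min_loss_candidates_def is_arg_min_def)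
  then have step: "removal_step prio E (P \<union> Q) = (P - {?c}) \<union> Q"
    using Suc.prems(2) by (auto simp: removal_step_def)
  have card: "n = card (P - {?c})" using Suc.hyps(2) Suc.prems(1) c by simp
  have "(removal_step prio E ^^ card (P - {?c})) ((P - {?c}) \<union> Q) = Q"
  proof (rule Suc.hyps(1)[OF card])
    show "\<exists>p \<in> R. \<forall>q \<in> Q. marginal_loss E (R \<union> Q) p < marginal_loss E (R \<union> Q) q"
      if "R \<subseteq> P - {?c}" "R \<noteq> {}" for R
      by (rule Suc.prems(3)) (use that in auto)
  qed (use Suc.prems in auto)
  then show ?case
    \<comment> \<open>The first removal has to be split off on the inside, since the induction
      hypothesis starts from the smaller set.\<close>
    using step card by (simp add: funpow_Suc_right del: funpow.simps flip: Suc.hyps(2))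
qed

text \<open>The division cuts voters 17 to 160 into 16 consecutive blocks of nine. The sizes 5, 3
  and 9 are chosen so that 5 < 5/2 + 3 and 5 + 3 < 9.\<close>

definition bad_ballot :: "nat \<Rightarrow> nat set" where
  "bad_ballot i =
    (if i \<le> 5 then {0, 1} else if i \<le> 10 then {0, 2} else if i \<le> 13 then {1}
     else if i \<le> 16 then {2} else {3 + (i - 17) div 9})"

definition bad_election :: "nat \<Rightarrow> nat election" where
  "bad_election r = \<lparr>num_voters = 160, candidates = {..<16 + r}, ballot = bad_ballot,
     committee_size = 16\<rparr>"

lemma bad_election_simps [simp]:
  "voters (bad_election r) = {1..160}" "num_voters (bad_election r) = 160"
  "candidates (bad_election r) = {..<16 + r}" "ballot (bad_election r) = bad_ballot"
  "committee_size (bad_election r) = 16"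
  by (simp_all add: bad_election_def voters_def)

lemma valid_bad_election:
  assumes "r \<ge> 3"
  shows "valid_election (bad_election r)"
proof -
  have "bad_ballot i \<subseteq> {..<16 + r}" if "i \<le> 160" for i
    using that assms by (auto simp: bad_ballot_def)
  moreover have "bad_ballot 1 \<noteq> {}" by (simp add: bad_ballot_def)
  ultimately show ?thesis
    using assms by (auto simp: valid_election_def intro!: bexI[of _ 1])
qed

lemma supporters:
  "{i. i \<in> {1..160} \<and> 0 \<in> bad_ballot i} = {1..10}"
  "{i. i \<in> {1..160} \<and> 1 \<in> bad_ballot i} = {1..5} \<union> {11..13}"
  "{i. i \<in> {1..160} \<and> 2 \<in> bad_ballot i} = {6..10} \<union> {14..16}"
  "3 \<le> c \<Longrightarrow> c < 19 \<Longrightarrow>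
    {i. i \<in> {1..160} \<and> c \<in> bad_ballot i} = {17 + 9 * (c - 3)..<26 + 9 * (c - 3)}"
  "19 \<le> c \<Longrightarrow> {i. i \<in> {1..160} \<and> c \<in> bad_ballot i} = {}"
  by (auto simp: bad_ballot_def split: if_splits)

lemma loss_0:
  assumes "finite S" "{0, 1, 2} \<subseteq> S"
  shows "marginal_loss (bad_election r) S 0 = 5"
proof -
  have "card (bad_ballot i \<inter> S) = 2" if "i \<in> {1..10}" for i
  proof -
    have "bad_ballot i \<inter> S = bad_ballot i" using that assms by (auto simp: bad_ballot_def)
    then show ?thesis using that by (auto simp: bad_ballot_def)
  qed
  moreover have "0 \<in> S" using assms(2) by simp
  ultimately show ?thesis
    unfolding marginal_loss_eq[OF assms(1) \<open>0 \<in> S\<close>] bad_election_simps supporters(1) by simp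
qed

lemma loss_1_2:
  assumes "finite S" "c = 1 \<or> c = 2" "c \<in> S"
  shows "marginal_loss (bad_election r) S c = (if 0 \<in> S then 11 / 2 else 8)"
proof -
  \<comment> \<open>A voter who approves both \<open>0\<close> and \<open>c\<close> contributes
    \<open>w\<close>: half a point while \<open>0\<close> is present, a full point
    afterwards.\<close>
  define w :: real where "w = (if 0 \<in> S then 1 / 2 else 1)"
  \<comment> \<open>\<open>I\<close> holds the approvers shared with \<open>0\<close>,
    \<open>J\<close> those of \<open>c\<close> alone; this treats the two symmetric candidates
    together.\<close>
  obtain I J where IJ: "{i. i \<in> {1..160} \<and> c \<in> bad_ballot i} = I \<union> J"
    "(c = 1 \<and> I = {1..5} \<and> J = {11..13}) \<or> (c = 2 \<and> I = {6..10} \<and> J = {14..16})"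
    using assms(2) supporters(2,3) by blast
  have I: "1 / real (card (bad_ballot i \<inter> S)) = w" if "i \<in> I" for i
  proof -
    have "bad_ballot i \<inter> S = (if 0 \<in> S then {0, c} else {c})"
      using that IJ(2) assms(3) by (auto simp: bad_ballot_def)
    then show ?thesis using assms(2) by (auto simp: w_def)
  qed
  have J: "1 / real (card (bad_ballot i \<inter> S)) = 1" if "i \<in> J" for i
  proof -
    have "bad_ballot i \<inter> S = {c}"
      using that IJ(2) assms(3) by (auto simp: bad_ballot_def)
    then show ?thesis by simp
  qed
  have fin: "finite I" "finite J" "I \<inter> J = {}" "card I = 5" "card J = 3" using IJ(2) by auto
  have "marginal_loss (bad_election r) S c =
      (\<Sum>i\<in>I. 1 / real (card (bad_ballot i \<inter> S))) + (\<Sum>i\<in>J. 1 / real (card (bad_ballot i \<inter> S)))"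
    unfolding marginal_loss_eq[OF assms(1,3)] bad_election_simps IJ(1)
    by (rule sum.union_disjoint[OF fin(1-3)])
  also have "\<dots> = 5 * w + 3" using I J fin by simp
  finally show ?thesis by (simp add: w_def)
qed

lemma loss_elected:
  assumes "finite S" "3 \<le> c" "c < 19" "c \<in> S"
  shows "marginal_loss (bad_election r) S c = 9"
proof -
  have "card (bad_ballot i \<inter> S) = 1" if "i \<in> {17 + 9 * (c - 3)..<26 + 9 * (c - 3)}" for i
  proof -
    have "bad_ballot i \<inter> S = {c}" using that assms by (auto simp: bad_ballot_def)
    then show ?thesis by simp
  qed
  then show ?thesis
    unfolding marginal_loss_eq[OF assms(1,4)] bad_election_simps supporters(4)[OF assms(2,3)]
    by simp
qed

lemma loss_dummy:
  assumes "finite S" "19 \<le> c" "c \<in> S"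
  shows "marginal_loss (bad_election r) S c = 0"
  unfolding marginal_loss_eq[OF assms(1,3)] bad_election_simps supporters(5)[OF assms(2)]
  by simp

text \<open>The run splits into three blocks whose order is forced by strict inequalities, so the
  outcome is the same for every \<open>prio\<close>.\<close>

lemma reverse_seq_pav_bad_election:
  assumes "linear_order prio" "r \<ge> 3"
  shows "reverse_seq_pav prio (bad_election r) = {3..<19}"
proof -
  let ?E = "bad_election r"
  let ?f = "removal_step prio ?E"
  \<comment> \<open>For \<open>r = 3\<close> this block is empty and takes no steps.\<close>
  have dummies: "(?f ^^ card {19..<16 + r}) ({19..<16 + r} \<union> {..<19}) = {..<19}"
  proof (rule removal_steps_block[OF assms(1)])
    fix R assume R: "R \<subseteq> {19..<16 + r}" "R \<noteq> {}"
    then obtain p where p: "p \<in> R" by blast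
    have fin: "finite (R \<union> {..<19})" using R finite_subset by auto
    have "marginal_loss ?E (R \<union> {..<19}) q > 0" if "q < 19" for q
    proof -
      consider "q = 0" | "q = 1 \<or> q = 2" | "3 \<le> q" by linarith
      then show ?thesis
      proof cases
        case 1
        then show ?thesis using loss_0[OF fin, of r] by auto
      next
        case 2
        then show ?thesis using loss_1_2[OF fin 2, of r] that by auto
      next
        case 3
        then show ?thesis using loss_elected[OF fin 3, of r] that by auto
      qed
    qed
    moreover have "marginal_loss ?E (R \<union> {..<19}) p = 0"
      using loss_dummy[OF fin] R p by auto
    ultimately show "\<exists>p\<in>R. \<forall>q\<in>{..<19}.
        marginal_loss ?E (R \<union> {..<19}) p < marginal_loss ?E (R \<union> {..<19}) q"
      using p by (intro bexI[of _ p]) simp_all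
  qed auto
  have zero: "(?f ^^ card {0::nat}) ({0} \<union> {1..<19}) = {1..<19}"
  proof (rule removal_steps_block[OF assms(1)])
    fix R :: "nat set" assume "R \<subseteq> {0}" "R \<noteq> {}"
    then have R: "R = {0}" by auto
    have "marginal_loss ?E ({0} \<union> {1..<19}) q > 5" if q: "q \<in> {1..<19}" for q
    proof (cases "q < 3")
      case True
      then have "q = 1 \<or> q = 2" using q by auto
      then show ?thesis using loss_1_2[of "{0} \<union> {1..<19}" q r] q by auto
    next
      case False
      then show ?thesis using loss_elected[of "{0} \<union> {1..<19}" q r] q by auto
    qed
    moreover have "marginal_loss ?E ({0} \<union> {1..<19}) 0 = 5" by (rule loss_0) auto
    ultimately show "\<exists>p\<in>R. \<forall>q\<in>{1..<19}.
        marginal_loss ?E (R \<union> {1..<19}) p < marginal_loss ?E (R \<union> {1..<19}) q"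
      using R by auto
  qed auto
  \<comment> \<open>\<open>1\<close> and \<open>2\<close> tie, so they form one block. No ballot
    contains both, hence the loss of either stays 8 when the other is gone.\<close>
  have one_two: "(?f ^^ card {1, 2::nat}) ({1, 2} \<union> {3..<19}) = {3..<19}"
  proof (rule removal_steps_block[OF assms(1)])
    fix R :: "nat set" assume R: "R \<subseteq> {1, 2}" "R \<noteq> {}"
    then obtain p where p: "p \<in> R" "p = 1 \<or> p = 2" by blast
    have fin: "finite (R \<union> {3..<19})" using R finite_subset by auto
    have "marginal_loss ?E (R \<union> {3..<19}) p = 8"
      using loss_1_2[OF fin p(2)] p(1) R by auto
    moreover have "marginal_loss ?E (R \<union> {3..<19}) q = 9" if "q \<in> {3..<19}" for q
      using loss_elected[OF fin] that by auto
    ultimately show "\<exists>p\<in>R. \<forall>q\<in>{3..<19}.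
        marginal_loss ?E (R \<union> {3..<19}) p < marginal_loss ?E (R \<union> {3..<19}) q"
      using p(1) by (intro bexI[of _ p]) simp_all
  qed auto
  have unions: "{..<16 + r} = {19..<16 + r} \<union> {..<19}" "{..<19} = {0} \<union> {1..<19::nat}"
    "{1..<19} = {1, 2} \<union> {3..<19::nat}"
    using assms(2) by auto
  \<comment> \<open>The blocks are summed in reverse order because \<open>funpow_add\<close> applies
    the last summand first.\<close>
  have "r = card {1, 2::nat} + (card {0::nat} + card {19..<16 + r})"
    using assms(2) by simp
  then have "(?f ^^ r) {..<16 + r} =
      (?f ^^ card {1, 2::nat}) ((?f ^^ card {0::nat}) ((?f ^^ card {19..<16 + r}) {..<16 + r}))"
    by (metis funpow_add o_apply)
  also have "\<dots> = {3..<19}"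
    using dummies zero one_two unions by metis
  finally show ?thesis by (simp add: reverse_seq_pav_def)
qed

theorem theorem2:
  fixes prio :: "nat rel" and r :: nat
  assumes "linear_order prio" and "r \<ge> 3"
  shows "\<exists>E :: nat election.
           valid_election E \<and>
           card (candidates E) - committee_size E = r \<and>
           \<not> satisfies_EJR E (reverse_seq_pav prio E)"
proof (intro exI conjI)
  let ?E = "bad_election r"
  show "valid_election ?E" by (rule valid_bad_election[OF assms(2)])
  show "card (candidates ?E) - committee_size ?E = r" by simp
  have "0 \<in> bad_ballot i" if "i \<in> {1..10}" for i using that by (auto simp: bad_ballot_def)
  \<comment> \<open>Voters 1 and 6 represent the two ballot types of the group, which share only
    \<open>0\<close>.\<close>
  moreover have "(\<Inter>i\<in>{1..10}. bad_ballot i) \<subseteq> bad_ballot 1 \<inter> bad_ballot 6" by auto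
  then have "(\<Inter>i\<in>{1..10}. bad_ballot i) \<subseteq> {0}" by (simp add: bad_ballot_def)
  ultimately have "(\<Inter>i\<in>{1..10}. bad_ballot i) = {0}" by blast
  then have "cohesive ?E 1 {1..10}" by (simp add: cohesive_def)
  moreover have "bad_ballot i \<inter> {3..<19} = {}" if "i \<in> {1..10}" for i
    using that by (auto simp: bad_ballot_def)
  ultimately show "\<not> satisfies_EJR ?E (reverse_seq_pav prio ?E)"
    unfolding satisfies_EJR_def reverse_seq_pav_bad_election[OF assms]
    by (auto intro!: exI[of _ 1] exI[of _ "{1..10}"])
qed

end
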